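(* Let $1<p<\infty$ be an integer, let $f:\mathcal X\to\mathbb R$ be convex, attain its minimum at $x^\ast$, and be strongly smooth of order $p$ with constants $0<L_1,\dots,L_p<\infty$. Let $\eta>0$ satisfy $0<\eta^{\frac{1}{p-1}}\le\min\left\{1,\frac{1}{2\sum_{m=2}^pL_m/m!}\right\}$, and let $h:\mathcal X\to\mathbb R$ be differentiable and satisfy $D_h(x,y)\ge\frac1p\|x-y\|^p$ for all $x,y\in\mathcal X$. Define $\delta>0$ by $\delta^{\frac{p}{p-1}}=\eta^{\frac{1}{p-1}}/2$, and set $A_k=(\delta/p)^pk^{(p)}$, $\alpha_k=\frac{A_{k+1}-A_k}{\delta}$, $\tau_k=\frac{\alpha_k}{A_{k+1}}$. Starting from $x_0=z_0$, let the sequences $(x_k),(y_k),(z_k)$ be generated for $k=0,1,2,\dots$ by $$x_k=\delta\tau_kz_k+(1-\delta\tau_k)y_k,$$ $$z_{k+1}=\arg\min_{z\in\mathcal X}\left\{\alpha_k\langle\nabla f(x_k),z\rangle+\frac1\delta D_h(z,z_k)\right\},$$ $$y_{k+1}=x_k-\eta^{\frac{1}{p-1}}\frac{B^{-1}\nabla f(x_k)}{\|\nabla f(x_k)\|_\ast^{\frac{p-2}{p-1}}}$$ (since $\delta\tau_0=1$, no value of $y_0$ is needed). Then for all $k\ge1$, $$f(y_k)-f(x^\ast)\le\frac{p^p\,D_h(x^\ast,z_0)}{(\delta k)^p}=O\left(1/(\delta k)^p\right).$$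
   Context: $\mathcal X$ (identified with $\mathbb R^d$) is a finite-dimensional real vector space with norm $\|v\|=\sqrt{\langle v,Bv\rangle}$ and dual norm $\|s\|_\ast=\sqrt{\langle s,B^{-1}s\rangle}$ on $\mathcal X^\ast$, where $B:\mathcal X\to\mathcal X^\ast$ is a positive definite self-adjoint operator. $D_h(x,y)=h(x)-h(y)-\langle\nabla h(y),x-y\rangle$ is the Bregman divergence of $h$, and $k^{(p)}=k(k+1)\cdots(k+p-1)$ is the rising factorial. For a $p$ times differentiable $f$, $\nabla^m f(x)(v)^m=\sum_{i_1,\dots,i_m=1}^d\partial_{x_{i_1}\cdots x_{i_m}}f(x)\prod_{j=1}^m v_{i_j}$. A function $f$ is strongly smooth of order $p$ (integer $p>1$) with constants $0<L_1,\dots,L_p<\infty$ if for $m=1,\dots,p-1$ and all $x$, $|\nabla^m f(x)(B^{-1}\nabla f(x))^m|\le L_m\|\nabla f(x)\|_\ast^{m+\frac{p-m}{p-1}}$, and moreover $|\nabla^p f(x)(v)^p|\le L_p\|v\|^p$ for all $x,v\in\mathcal X$. If $\nabla f(x_k)=0$, the $y$-update is $y_{k+1}=x_k$. *)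

theory Defs
  imports "HOL-Analysis.Analysis" "HOL-Library.Landau_Symbols"
begin

text \<open>
  The space is a Euclidean space \<open>'a\<close> with its orthonormal basis \<open>Basis\<close> as coordinate system;
  its dual is identified with \<open>'a\<close> through the pairing \<open>s \<bullet> v\<close>. In particular, gradients are
  dual vectors, and an operator from the space to its dual is a map on \<open>'a\<close>.
\<close>

definition pos_def_selfadjoint :: "('a::euclidean_space \<Rightarrow> 'a) \<Rightarrow> bool" where
  "pos_def_selfadjoint B \<longleftrightarrow>
     linear B \<and> adjoint B = B \<and> (\<forall>v. v \<noteq> 0 \<longrightarrow> v \<bullet> B v > 0)"

definition norm_on :: "('a::euclidean_space \<Rightarrow> 'a) \<Rightarrow> 'a \<Rightarrow> real" where
  "norm_on B v = sqrt (v \<bullet> B v)"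

definition dual_norm_on :: "('a::euclidean_space \<Rightarrow> 'a) \<Rightarrow> 'a \<Rightarrow> real" where
  "dual_norm_on B s = sqrt (s \<bullet> inv B s)"

definition gradient :: "('a::euclidean_space \<Rightarrow> real) \<Rightarrow> 'a \<Rightarrow> 'a" where
  "gradient f x = (THE g. GDERIV f x :> g)"

definition bregman :: "('a::euclidean_space \<Rightarrow> real) \<Rightarrow> 'a \<Rightarrow> 'a \<Rightarrow> real" where
  "bregman h x y = h x - h y - gradient h y \<bullet> (x - y)"

definition partial_deriv :: "'a::euclidean_space \<Rightarrow> ('a \<Rightarrow> real) \<Rightarrow> 'a \<Rightarrow> real" where
  "partial_deriv i f x = deriv (\<lambda>t. f (x + t *\<^sub>R i)) 0"

text \<open>
  The derivative of \<open>f\<close> exists and is differentiable \<open>n\<close> times iff this holds for each of its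
  coordinates, which are the partial derivatives. Continuity of the highest derivative is
  not required.
\<close>

primrec times_differentiable :: "nat \<Rightarrow> ('a::euclidean_space \<Rightarrow> real) \<Rightarrow> bool" where
  "times_differentiable 0 f \<longleftrightarrow> True"
| "times_differentiable (Suc n) f \<longleftrightarrow>
     (\<forall>x. f differentiable at x) \<and> (\<forall>i\<in>Basis. times_differentiable n (partial_deriv i f))"

text \<open>
  \<open>nabla_pow m f x v\<close> is \<open>\<nabla>\<^sup>m f(x)(v)\<^sup>m\<close>. The lists \<open>js = [i\<^sub>1, \<dots>, i\<^sub>m]\<close> of basis vectors are the
  multi-indices, and \<open>foldr partial_deriv js f\<close> is the iterated partial derivative
  along \<open>i\<^sub>1, \<dots>, i\<^sub>m\<close>.
\<close>

definition nabla_pow :: "nat \<Rightarrow> ('a::euclidean_space \<Rightarrow> real) \<Rightarrow> 'a \<Rightarrow> 'a \<Rightarrow> real" where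
  "nabla_pow m f x v =
     (\<Sum>js | set js \<subseteq> Basis \<and> length js = m.
        foldr partial_deriv js f x * (\<Prod>i\<leftarrow>js. v \<bullet> i))"

text \<open>
  The exponent of the dual norm is positive, so at a critical point
  the first bound reads \<open>0 \<le> 0\<close>.
\<close>

definition strongly_smooth ::
    "('a::euclidean_space \<Rightarrow> 'a) \<Rightarrow> nat \<Rightarrow> (nat \<Rightarrow> real) \<Rightarrow> ('a \<Rightarrow> real) \<Rightarrow> bool" where
  "strongly_smooth B p L f \<longleftrightarrow>
     1 < p \<and> times_differentiable p f \<and> (\<forall>m\<in>{1..p}. 0 < L m) \<and>
     (\<forall>m\<in>{1..p - 1}. \<forall>x.
        \<bar>nabla_pow m f x (inv B (gradient f x))\<bar>
          \<le> L m * dual_norm_on B (gradient f x)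
                   powr (real m + (real p - real m) / (real p - 1))) \<and>
     (\<forall>x v. \<bar>nabla_pow p f x v\<bar> \<le> L p * norm_on B v ^ p)"

end

theory Submission
  imports Defs
begin

text \<open>
  Taylor expansion of \<open>f\<close> along the rescaled gradient step bounds each term of order \<open>m \<ge> 2\<close> by
  \<open>c\<^sup>2 (L\<^sub>m/m!) \<parallel>\<nabla>f(x)\<parallel>\<^sub>*\<^bsup>p/(p-1)\<^esup>\<close> with \<open>c = \<eta>\<^bsup>1/(p-1)\<^esup>\<close>, so the step decreases \<open>f\<close> by at least
  \<open>(c/2) \<parallel>\<nabla>f(x)\<parallel>\<^sub>*\<^bsup>p/(p-1)\<^esup> = (\<delta> \<parallel>\<nabla>f(x)\<parallel>\<^sub>*)\<^bsup>p/(p-1)\<^esup>\<close>. The mirror step increases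
  \<open>D\<^sub>h(x\<^sup>*, z\<^sub>k)\<close> by at most a linear term, which convexity of \<open>f\<close> absorbs, plus a Fenchel-Young
  error \<open>((A\<^sub>k\<^sub>+\<^sub>1 - A\<^sub>k) \<parallel>\<nabla>f(x\<^sub>k)\<parallel>\<^sub>*)\<^bsup>p/(p-1)\<^esup>\<close>. Rising factorials are the weights for which
  \<open>(A\<^sub>k\<^sub>+\<^sub>1 - A\<^sub>k)\<^bsup>p/(p-1)\<^esup> \<le> \<delta>\<^bsup>p/(p-1)\<^esup> A\<^sub>k\<^sub>+\<^sub>1\<close>, so the decrease of \<open>f\<close> pays for this error and
  \<open>A\<^sub>k (f(y\<^sub>k) - f(x\<^sup>*)) + D\<^sub>h(x\<^sup>*, z\<^sub>k)\<close> never increases. It starts at \<open>D\<^sub>h(x\<^sup>*, z\<^sub>0)\<close> as \<open>A\<^sub>0 = 0\<close>.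
\<close>

section \<open>Gradients, derivatives along lines, and convexity\<close>

lemma GDERIV_gradient:
  fixes f :: "'a::euclidean_space \<Rightarrow> real"
  assumes "f differentiable at x"
  shows "GDERIV f x :> gradient f x"
proof -
  obtain D where D: "(f has_derivative D) (at x)"
    using assms by (auto simp: differentiable_def)
  have "D v = v \<bullet> adjoint D 1" for v
    using adjoint_works[OF has_derivative_linear[OF D], of v 1] by simp
  then have "D = (\<lambda>v. v \<bullet> adjoint D 1)"
    by blast
  with D have "GDERIV f x :> adjoint D 1"
    by (metis gderiv_def)
  moreover have "g = g'" if "GDERIV f x :> g" "GDERIV f x :> g'" for g g'
  proof -
    have "(\<lambda>v. v \<bullet> g) = (\<lambda>v. v \<bullet> g')"
      using that has_derivative_unique unfolding gderiv_def by blast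
    then show ?thesis
      by (metis vector_eq_ldot)
  qed
  ultimately show ?thesis
    unfolding gradient_def by (metis theI)
qed

lemma DERIV_along_line:
  fixes f :: "'a::euclidean_space \<Rightarrow> real"
  assumes "f differentiable at (x + t *\<^sub>R v)"
  shows "((\<lambda>t. f (x + t *\<^sub>R v)) has_real_derivative gradient f (x + t *\<^sub>R v) \<bullet> v) (at t)"
proof -
  have "(f has_derivative (\<lambda>w. w \<bullet> gradient f (x + t *\<^sub>R v))) (at (x + t *\<^sub>R v))"
    using GDERIV_gradient[OF assms] by (simp add: gderiv_def)
  moreover have "((\<lambda>t. x + t *\<^sub>R v) has_derivative (\<lambda>s. s *\<^sub>R v)) (at t)"
    by (auto intro!: derivative_eq_intros)
  ultimately have "((\<lambda>t. f (x + t *\<^sub>R v)) has_derivative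
      (\<lambda>s. (s *\<^sub>R v) \<bullet> gradient f (x + t *\<^sub>R v))) (at t)"
    using has_derivative_compose by blast
  then show ?thesis
    by (simp add: has_field_derivative_def inner_commute mult.commute[of "v \<bullet> _"]
      mult_commute_abs)
qed

lemma partial_deriv_eq_gradient:
  assumes "f differentiable at x"
  shows "partial_deriv i f x = gradient f x \<bullet> i"
  unfolding partial_deriv_def
  using DERIV_along_line[of f x 0 i] assms by (simp add: DERIV_imp_deriv)

text \<open>\<open>?\<psi>\<close> is \<open>f\<close> on the segment with the slope of its chord
  removed. Convexity gives \<open>?\<psi> t \<le> ?\<psi> 0\<close> there, while a tangent above
  \<open>f y\<close> would make \<open>?\<psi>\<close> exceed \<open>?\<psi> 0\<close> just to the
  right of 0.\<close>

lemma convex_above_gradient: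
  fixes f :: "'a::euclidean_space \<Rightarrow> real"
  assumes convex: "convex_on UNIV f" and diff: "f differentiable at x"
  shows "f x + gradient f x \<bullet> (y - x) \<le> f y"
proof (rule ccontr)
  assume "\<not> ?thesis"
  then have pos: "gradient f x \<bullet> (y - x) - (f y - f x) > 0"
    by simp
  let ?\<psi> = "\<lambda>t. f (x + t *\<^sub>R (y - x)) - t * (f y - f x)"
  have "(?\<psi> has_real_derivative gradient f x \<bullet> (y - x) - (f y - f x)) (at 0)"
    using DERIV_along_line[of f x 0 "y - x"] diff by (auto intro!: derivative_eq_intros)
  from DERIV_pos_inc_right[OF this pos] obtain d where d: "d > 0"
    "\<And>t. 0 < t \<Longrightarrow> t < d \<Longrightarrow> ?\<psi> 0 < ?\<psi> t"
    by auto
  define t where "t = min (d / 2) 1"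
  have t: "0 < t" "t < d" "t \<le> 1"
    using \<open>d > 0\<close> by (auto simp: t_def min_def)
  have "f ((1 - t) *\<^sub>R x + t *\<^sub>R y) \<le> (1 - t) * f x + t * f y"
    using convex_onD[OF convex, of t x y] t by simp
  moreover have "(1 - t) *\<^sub>R x + t *\<^sub>R y = x + t *\<^sub>R (y - x)"
    by (simp add: algebra_simps)
  ultimately have "?\<psi> t \<le> ?\<psi> 0"
    by (simp add: algebra_simps)
  with d(2)[OF t(1,2)] show False
    by simp
qed

section \<open>Iterated partial derivatives and Taylor's formula\<close>

lemma times_differentiable_foldr_partial_deriv:
  assumes "times_differentiable (length js + n) f" "set js \<subseteq> Basis"
  shows "times_differentiable n (foldr partial_deriv js f)"
  using assms
proof (induction js arbitrary: n)
  case (Cons j js)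
  then have "times_differentiable (Suc n) (foldr partial_deriv js f)"
    by (intro Cons.IH) (simp_all del: times_differentiable.simps)
  then show ?case
    using Cons.prems(2) by auto
qed simp

text \<open>The head of a multi-index is the outermost derivative of the \<open>foldr\<close>.
  Splitting it off exposes the derivative along \<open>v\<close> of each partial derivative of order
  \<open>m\<close>.\<close>

lemma nabla_pow_Suc:
  "nabla_pow (Suc m) f x v =
    (\<Sum>js | set js \<subseteq> Basis \<and> length js = m.
      (\<Sum>i\<in>Basis. (v \<bullet> i) * partial_deriv i (foldr partial_deriv js f) x)
        * (\<Prod>i\<leftarrow>js. v \<bullet> i))"
proof -
  let ?J = "{js :: 'a list. set js \<subseteq> Basis \<and> length js = m}"
  have *: "{js :: 'a list. set js \<subseteq> Basis \<and> length js = Suc m} =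
      (\<lambda>(i, js). i # js) ` (Basis \<times> ?J)"
    by (auto simp: length_Suc_conv image_iff)
  have "inj_on (\<lambda>(i :: 'a, js). i # js) (Basis \<times> ?J)"
    by (auto simp: inj_on_def)
  then have "nabla_pow (Suc m) f x v = (\<Sum>(i, js)\<in>Basis \<times> ?J.
      (v \<bullet> i) * partial_deriv i (foldr partial_deriv js f) x * (\<Prod>i\<leftarrow>js. v \<bullet> i))"
    unfolding nabla_pow_def * by (subst sum.reindex) (auto simp: case_prod_unfold mult_ac)
  also have "\<dots> = (\<Sum>i\<in>Basis. \<Sum>js\<in>?J.
      (v \<bullet> i) * partial_deriv i (foldr partial_deriv js f) x * (\<Prod>i\<leftarrow>js. v \<bullet> i))"
    by (simp add: sum.cartesian_product)
  also have "\<dots> = (\<Sum>js\<in>?J. \<Sum>i\<in>Basis.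
      (v \<bullet> i) * partial_deriv i (foldr partial_deriv js f) x * (\<Prod>i\<leftarrow>js. v \<bullet> i))"
    by (rule sum.swap)
  finally show ?thesis
    by (simp add: sum_distrib_right)
qed

lemma DERIV_nabla_pow:
  assumes "times_differentiable (Suc m) f"
  shows "((\<lambda>t. nabla_pow m f (x + t *\<^sub>R v) v) has_real_derivative
    nabla_pow (Suc m) f (x + t *\<^sub>R v) v) (at t)"
proof -
  let ?X = "x + t *\<^sub>R v"
  have "((\<lambda>t. foldr partial_deriv js f (x + t *\<^sub>R v)) has_real_derivative
      (\<Sum>i\<in>Basis. (v \<bullet> i) * partial_deriv i (foldr partial_deriv js f) ?X)) (at t)"
    if "set js \<subseteq> Basis" "length js = m" for js
  proof -
    let ?g = "foldr partial_deriv js f"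
    have "times_differentiable (Suc 0) ?g"
      using assms that by (intro times_differentiable_foldr_partial_deriv) auto
    then have diff: "?g differentiable at ?X"
      by simp
    have "gradient ?g ?X \<bullet> v = (\<Sum>i\<in>Basis. (v \<bullet> i) * partial_deriv i ?g ?X)"
      by (subst euclidean_inner) (simp add: partial_deriv_eq_gradient[OF diff] mult.commute)
    then show ?thesis
      using DERIV_along_line[OF diff] by simp
  qed
  then show ?thesis
    \<comment> \<open>This must act first: \<open>nabla_pow_def\<close> would also unfold the
      derivative of order \<open>Suc m\<close> and hide the inner sum over coordinates.\<close>
    unfolding nabla_pow_Suc
    unfolding nabla_pow_def
    by (intro DERIV_sum DERIV_cmult_right) auto
qed

lemma nabla_pow_0: "nabla_pow 0 f x v = f x"
proof -
  have "{js :: 'a list. set js \<subseteq> Basis \<and> length js = 0} = {[]}"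
    by auto
  then show ?thesis
    by (simp add: nabla_pow_def)
qed

text \<open>Both sides are the slope at 0 of \<open>f\<close> along \<open>v\<close>, so uniqueness
  of the derivative replaces a computation with one-element lists.\<close>

lemma nabla_pow_1:
  assumes "\<forall>x. f differentiable at x"
  shows "nabla_pow 1 f x v = gradient f x \<bullet> v"
proof (rule DERIV_unique)
  have "times_differentiable (Suc 0) f"
    using assms by simp
  from DERIV_nabla_pow[OF this, of x v 0]
  show "((\<lambda>t. f (x + t *\<^sub>R v)) has_real_derivative nabla_pow 1 f x v) (at 0)"
    by (simp add: nabla_pow_0)
  show "((\<lambda>t. f (x + t *\<^sub>R v)) has_real_derivative gradient f x \<bullet> v) (at 0)"
    using DERIV_along_line[of f x 0 v] assms by simp
qed

lemma nabla_pow_scaleR: "nabla_pow m f x (c *\<^sub>R v) = c ^ m * nabla_pow m f x v"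
proof -
  have "(\<Prod>i\<leftarrow>js. (c *\<^sub>R v) \<bullet> i) = c ^ length js * (\<Prod>i\<leftarrow>js. v \<bullet> i)" for js
    by (induction js) auto
  then show ?thesis
    unfolding nabla_pow_def sum_distrib_left by (intro sum.cong) (auto simp del: inner_scaleR_left)
qed

lemma times_differentiable_mono:
  assumes "times_differentiable n f" "m \<le> n"
  shows "times_differentiable m f"
  using assms
proof (induction m arbitrary: n f)
  case (Suc m)
  then obtain k where "n = Suc k" "m \<le> k"
    by (cases n) auto
  with Suc show ?case
    by auto
qed simp

text \<open>One-variable Taylor formula along the line, evaluated at 1. Lagrange's remainder asks
  only that the derivative of order \<open>n\<close> exist, which is all that
  \<open>times_differentiable\<close> provides.\<close>

lemma nabla_pow_Taylor:
  fixes f :: "'a::euclidean_space \<Rightarrow> real"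
  assumes "times_differentiable n f" "0 < n"
  obtains \<xi> where "f (x + v) =
    (\<Sum>m<n. nabla_pow m f x v / fact m) + nabla_pow n f \<xi> v / fact n"
proof -
  have "\<exists>t::real. 0 < t \<and> t < 1 \<and> f (x + 1 *\<^sub>R v) =
      (\<Sum>m<n. (nabla_pow m f (x + 0 *\<^sub>R v) v / fact m) * 1 ^ m)
        + (nabla_pow n f (x + t *\<^sub>R v) v / fact n) * 1 ^ n"
  proof (rule Maclaurin[where f = "\<lambda>t. f (x + t *\<^sub>R v)"])
    show "\<forall>m t. m < n \<and> 0 \<le> t \<and> t \<le> 1 \<longrightarrow>
        ((\<lambda>t. nabla_pow m f (x + t *\<^sub>R v) v) has_real_derivative
          nabla_pow (Suc m) f (x + t *\<^sub>R v) v) (at t)"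
      using assms(1) times_differentiable_mono DERIV_nabla_pow by (metis Suc_leI)
  qed (use assms(2) in \<open>auto simp: nabla_pow_0\<close>)
  then show ?thesis
    using that by auto
qed

section \<open>The norm of \<open>B\<close> and its dual norm\<close>

context
  fixes B :: "'a::euclidean_space \<Rightarrow> 'a"
  assumes B: "pos_def_selfadjoint B"
begin

lemma pos_def_selfadjoint_linear: "linear B"
  using B by (simp add: pos_def_selfadjoint_def)

lemma pos_def_selfadjoint_symmetric: "u \<bullet> B v = B u \<bullet> v"
  using B adjoint_works[OF pos_def_selfadjoint_linear] by (metis pos_def_selfadjoint_def)

lemma pos_def_selfadjoint_nonneg: "0 \<le> v \<bullet> B v"
  using B linear_0[OF pos_def_selfadjoint_linear]
  by (cases "v = 0") (auto simp: pos_def_selfadjoint_def less_imp_le)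

lemma pos_def_selfadjoint_inj: "inj B"
  unfolding linear_injective_0[OF pos_def_selfadjoint_linear] using B
  by (force simp: pos_def_selfadjoint_def)

lemma pos_def_selfadjoint_inv_right: "B (inv B s) = s"
proof -
  have "surj B"
    using linear_injective_imp_surjective[OF pos_def_selfadjoint_linear pos_def_selfadjoint_inj]
    by blast
  then show ?thesis
    by (rule surj_f_inv_f)
qed

text \<open>Substituting \<open>s = B w\<close> turns the dual quadratic form into the primal one,
  so facts about \<open>B\<close> carry over to the dual norm.\<close>

lemma inner_inv_eq_inner: "s \<bullet> inv B s = inv B s \<bullet> B (inv B s)"
  by (simp add: pos_def_selfadjoint_inv_right inner_commute)

lemma dual_norm_on_nonneg: "0 \<le> dual_norm_on B s"
  by (simp add: dual_norm_on_def inner_inv_eq_inner pos_def_selfadjoint_nonneg)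

lemma dual_norm_on_pos:
  assumes "s \<noteq> 0"
  shows "0 < dual_norm_on B s"
proof -
  have "inv B s \<noteq> 0"
    using assms pos_def_selfadjoint_inv_right linear_0[OF pos_def_selfadjoint_linear] by metis
  then show ?thesis
    using B by (simp add: dual_norm_on_def inner_inv_eq_inner pos_def_selfadjoint_def)
qed

lemma dual_norm_on_scaleR: "dual_norm_on B (a *\<^sub>R s) = \<bar>a\<bar> * dual_norm_on B s"
proof -
  have "B (inv B (a *\<^sub>R s)) = B (a *\<^sub>R inv B s)"
    by (simp add: pos_def_selfadjoint_inv_right linear_scale[OF pos_def_selfadjoint_linear])
  then have "inv B (a *\<^sub>R s) = a *\<^sub>R inv B s"
    using pos_def_selfadjoint_inj by (simp add: inj_eq)
  then have "dual_norm_on B (a *\<^sub>R s) = sqrt (a\<^sup>2 * (s \<bullet> inv B s))"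
    by (simp add: dual_norm_on_def power2_eq_square mult.assoc)
  then show ?thesis
    by (simp add: dual_norm_on_def real_sqrt_mult)
qed

lemma inner_inv_eq_dual_norm_on: "s \<bullet> inv B s = (dual_norm_on B s)\<^sup>2"
  by (simp add: dual_norm_on_def inner_inv_eq_inner pos_def_selfadjoint_nonneg)

lemma norm_on_inv: "norm_on B (inv B s) = dual_norm_on B s"
  by (simp add: norm_on_def dual_norm_on_def inner_inv_eq_inner)

text \<open>Cauchy-Schwarz for the inner product of \<open>B\<close>, in which
  \<open>s \<bullet> v\<close> is the product of \<open>inv B s\<close> and \<open>v\<close>:
  subtracting from \<open>v\<close> its projection onto \<open>inv B s\<close> leaves a nonnegative
  square.\<close>

lemma inner_le_dual_norm_mult_norm: "s \<bullet> v \<le> dual_norm_on B s * norm_on B v"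
proof (cases "s = 0")
  case False
  let ?w = "inv B s"
  let ?a = "s \<bullet> ?w"
  let ?t = "(s \<bullet> v) / ?a"
  have a: "0 < ?a"
    using dual_norm_on_pos[OF False] by (simp add: inner_inv_eq_dual_norm_on)
  have "0 \<le> (v - ?t *\<^sub>R ?w) \<bullet> B (v - ?t *\<^sub>R ?w)"
    by (rule pos_def_selfadjoint_nonneg)
  also have "\<dots> = v \<bullet> B v - 2 * ?t * (s \<bullet> v) + ?t\<^sup>2 * ?a"
    using pos_def_selfadjoint_symmetric[of ?w v]
    by (simp add: linear_diff[OF pos_def_selfadjoint_linear]
      linear_scale[OF pos_def_selfadjoint_linear] pos_def_selfadjoint_inv_right algebra_simps
      inner_commute power2_eq_square)
  also have "\<dots> = v \<bullet> B v - (s \<bullet> v)\<^sup>2 / ?a"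
    using a by (simp add: field_simps power2_eq_square)
  finally have "(s \<bullet> v)\<^sup>2 \<le> ?a * (v \<bullet> B v)"
    using a by (simp add: field_simps)
  then have "s \<bullet> v \<le> sqrt (?a * (v \<bullet> B v))"
    by (rule real_le_rsqrt)
  then show ?thesis
    by (simp add: dual_norm_on_def norm_on_def real_sqrt_mult)
qed (simp add: dual_norm_on_def)

lemma norm_on_nonneg: "0 \<le> norm_on B v"
  by (simp add: norm_on_def pos_def_selfadjoint_nonneg)

lemma norm_on_minus: "norm_on B (- v) = norm_on B v"
  by (simp add: norm_on_def linear_neg[OF pos_def_selfadjoint_linear])

text \<open>Cauchy-Schwarz, then Young's inequality with the conjugate exponents p/(p-1) and
  p.\<close>

lemma fenchel_young:
  assumes "1 < p"
  shows "s \<bullet> v - 1 / real p * norm_on B v ^ p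
    \<le> (real p - 1) / real p * dual_norm_on B s powr (real p / (real p - 1))"
proof -
  have norm: "0 \<le> norm_on B v"
    by (simp add: norm_on_def pos_def_selfadjoint_nonneg)
  have "s \<bullet> v \<le> dual_norm_on B s * norm_on B v"
    by (rule inner_le_dual_norm_mult_norm)
  also have "\<dots> \<le> dual_norm_on B s powr (real p / (real p - 1)) / (real p / (real p - 1))
      + norm_on B v powr real p / real p"
    using assms norm dual_norm_on_nonneg
    by (intro Youngs_inequality) (auto simp: field_simps)
  also have "norm_on B v powr real p = norm_on B v ^ p"
    using norm assms by (simp add: powr_realpow')
  finally show ?thesis
    by (simp add: field_simps)
qed

section \<open>Descent of the rescaled gradient step\<close>

lemma rescaled_gradient_descent:
  fixes f :: "'a \<Rightarrow> real"
  assumes smooth: "strongly_smooth B p L f"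
    and c: "0 < c" "c \<le> 1" "c \<le> 1 / (2 * (\<Sum>m=2..p. L m / fact m))"
    and g: "gradient f x \<noteq> 0"
  shows "f (x - (c / dual_norm_on B (gradient f x) powr ((real p - 2) / (real p - 1)))
      *\<^sub>R inv B (gradient f x))
    \<le> f x - c / 2 * dual_norm_on B (gradient f x) powr (real p / (real p - 1))"
proof -
  define v where "v = inv B (gradient f x)"
  define G where "G = dual_norm_on B (gradient f x)"
  define s where "s = c / G powr ((real p - 2) / (real p - 1))"
  define Q where "Q = G powr (real p / (real p - 1))"
  define S where "S = (\<Sum>m=2..p. L m / fact m)"
  have p: "1 < p" and diff: "times_differentiable p f" and L: "\<And>m. m \<in> {1..p} \<Longrightarrow> 0 < L m"
    and low: "\<And>m x. m \<in> {1..p - 1} \<Longrightarrow> \<bar>nabla_pow m f x (inv B (gradient f x))\<bar>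
        \<le> L m * dual_norm_on B (gradient f x) powr (real m + (real p - real m) / (real p - 1))"
    and top: "\<And>x v. \<bar>nabla_pow p f x v\<bar> \<le> L p * norm_on B v ^ p"
    using smooth by (auto simp: strongly_smooth_def)
  have G: "0 < G"
    unfolding G_def by (rule dual_norm_on_pos[OF g])
  have s: "0 < s"
    using G c by (simp add: s_def)
  \<comment> \<open>The exponents in \<open>strongly_smooth\<close> are made for this: the step
    length brings every order to the same power \<open>Q\<close> of the gradient norm, leaving only
    \<open>c ^ m\<close>.\<close>
  have scale: "s ^ m * G powr (real m + (real p - real m) / (real p - 1)) = c ^ m * Q" for m
  proof -
    have "s = c * G powr (- ((real p - 2) / (real p - 1)))"
      by (simp add: s_def powr_minus divide_inverse)
    then have "s ^ m * G powr (real m + (real p - real m) / (real p - 1)) =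
        c ^ m * G powr (real m * - ((real p - 2) / (real p - 1))
          + (real m + (real p - real m) / (real p - 1)))"
      using G by (simp add: power_mult_distrib powr_power mult.assoc flip: powr_add)
    also have "real m * - ((real p - 2) / (real p - 1))
        + (real m + (real p - real m) / (real p - 1)) = real p / (real p - 1)"
    proof -
      define d where "d = real p - 1"
      have "d \<noteq> 0" "real p = d + 1"
        using p by (auto simp: d_def)
      then show ?thesis
        by (simp add: field_simps)
    qed
    finally show ?thesis
      by (simp add: Q_def)
  qed
  obtain \<xi> where "f (x + (- s) *\<^sub>R v) =
      (\<Sum>m<p. nabla_pow m f x ((- s) *\<^sub>R v) / fact m) + nabla_pow p f \<xi> ((- s) *\<^sub>R v) / fact p"
    using nabla_pow_Taylor[OF diff] p by (metis less_trans zero_less_one)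
  then have taylor: "f (x - s *\<^sub>R v) =
      (\<Sum>m<p. (- s) ^ m * nabla_pow m f x v / fact m) + (- s) ^ p * nabla_pow p f \<xi> v / fact p"
    by (simp add: nabla_pow_scaleR del: scaleR_minus_left) simp
  \<comment> \<open>Keeping \<open>d\<close> abstract covers both the terms at \<open>x\<close> and
    the remainder at \<open>\<xi>\<close>. As c is at most 1, every \<open>c ^ m\<close> with m at
    least 2 is at most \<open>c\<^sup>2\<close>.\<close>
  have term_le: "(- s) ^ m * d / fact m \<le> c\<^sup>2 * Q * (L m / fact m)"
    if m: "2 \<le> m" "m \<le> p" and d: "\<bar>d\<bar> \<le> L m * G powr (real m + (real p - real m) / (real p - 1))"
    for m d
  proof -
    have "(- s) ^ m * d \<le> \<bar>(- s) ^ m * d\<bar>"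
      by simp
    also have "\<dots> = s ^ m * \<bar>d\<bar>"
      using s by (simp add: abs_mult power_abs)
    also have "\<dots> \<le> s ^ m * (L m * G powr (real m + (real p - real m) / (real p - 1)))"
      using s d by (intro mult_left_mono) auto
    also have "\<dots> = L m * (c ^ m * Q)"
      by (simp flip: scale)
    also have "\<dots> \<le> L m * (c\<^sup>2 * Q)"
      using L[of m] m c by (intro mult_left_mono mult_right_mono power_decreasing) (auto simp: Q_def)
    finally show ?thesis
      by (simp add: divide_right_mono field_simps)
  qed
  \<comment> \<open>The linear term is computed exactly, since it supplies the whole gain.\<close>
  have first: "(- s) ^ 1 * nabla_pow 1 f x v = - (c * Q)"
  proof -
    have "\<forall>x. f differentiable at x"
      using diff p by (cases p) auto
    then have "nabla_pow 1 f x v = G\<^sup>2"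
      by (subst nabla_pow_1) (simp_all add: v_def G_def inner_inv_eq_dual_norm_on)
    moreover have "real 1 + (real p - real 1) / (real p - 1) = 2"
      using p by simp
    ultimately show ?thesis
      using scale[of 1] G by simp
  qed
  \<comment> \<open>The bound of order \<open>p\<close> holds at every point, so the unknown
    \<open>\<xi>\<close> is harmless; \<open>v\<close> has norm \<open>G\<close>, and the exponent
    at \<open>m = p\<close> is \<open>p\<close>.\<close>
  have last: "(- s) ^ p * nabla_pow p f \<xi> v / fact p \<le> c\<^sup>2 * Q * (L p / fact p)"
    using top[of \<xi> v] p G
    by (intro term_le) (auto simp: v_def norm_on_inv powr_realpow simp flip: G_def)
  have "f (x - s *\<^sub>R v) = f x - c * Q
      + ((\<Sum>m=2..<p. (- s) ^ m * nabla_pow m f x v / fact m)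
        + (- s) ^ p * nabla_pow p f \<xi> v / fact p)"
  proof -
    have "{..<p} = {0, 1} \<union> {2..<p}"
      using p by auto
    then show ?thesis
      unfolding taylor using first by (simp add: sum.union_disjoint nabla_pow_0)
  qed
  also have "\<dots> \<le> f x - c * Q + ((\<Sum>m=2..<p. c\<^sup>2 * Q * (L m / fact m)) + c\<^sup>2 * Q * (L p / fact p))"
    using low[of _ x]
    by (intro add_left_mono add_mono last sum_mono term_le) (auto simp: v_def G_def)
  also have "\<dots> = f x - c * Q + c * Q * (c * S)"
  proof -
    have "{2..p} = insert p {2..<p}"
      using p by auto
    then show ?thesis
      unfolding S_def sum_distrib_left[symmetric]
      by (simp add: power2_eq_square algebra_simps)
  qed
  \<comment> \<open>The step size condition lets the higher orders consume at most half of the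
    linear gain.\<close>
  also have "\<dots> \<le> f x - c * Q + c * Q * (1 / 2)"
  proof -
    have "0 < S"
      unfolding S_def using p L by (intro sum_pos) auto
    then have "c * S \<le> 1 / 2"
      using c(3) by (simp add: field_simps flip: S_def)
    then show ?thesis
      using c by (intro add_left_mono mult_left_mono) (auto simp: Q_def)
  qed
  finally show ?thesis
    by (simp add: s_def v_def Q_def G_def)
qed

end

section \<open>Bregman divergence and the mirror step\<close>

lemma bregman_three_point:
  "bregman h u w = bregman h u z - bregman h w z - (gradient h w - gradient h z) \<bullet> (u - w)"
  by (simp add: bregman_def algebra_simps)

text \<open>\<open>?D\<close> is the gradient of the objective at \<open>w\<close>. The slope along
  \<open>?D\<close> itself is \<open>?D \<bullet> ?D\<close>, which must vanish at a
  minimum.\<close>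

lemma gradient_bregman_minimizer:
  fixes h :: "'a::euclidean_space \<Rightarrow> real"
  assumes diff: "\<forall>u. h differentiable at u"
    and min: "is_arg_min (\<lambda>u. a * (g \<bullet> u) + b * bregman h u z) (\<lambda>_. True) w"
  shows "b *\<^sub>R (gradient h w - gradient h z) = - (a *\<^sub>R g)"
proof -
  let ?\<phi> = "\<lambda>u. a * (g \<bullet> u) + b * bregman h u z"
  let ?D = "b *\<^sub>R (gradient h w - gradient h z) + a *\<^sub>R g"
  have "((\<lambda>t. ?\<phi> (w + t *\<^sub>R ?D)) has_real_derivative ?D \<bullet> ?D) (at 0)"
    unfolding bregman_def using DERIV_along_line[of h w 0 ?D] diff
    by (auto intro!: derivative_eq_intros simp: inner_right_distrib inner_left_distrib
      inner_diff_left algebra_simps)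
  moreover have "\<forall>t. \<bar>0 - t\<bar> < 1 \<longrightarrow> ?\<phi> (w + 0 *\<^sub>R ?D) \<le> ?\<phi> (w + t *\<^sub>R ?D)"
    using min by (simp add: is_arg_min_linorder)
  ultimately have "?D \<bullet> ?D = 0"
    using DERIV_local_min zero_less_one by blast
  then show ?thesis
    by (simp add: add_eq_0_iff2)
qed

section \<open>Rising factorial weights and the potential argument\<close>

lemma pochhammer_le_power:
  fixes a :: real
  assumes "0 \<le> a"
  shows "pochhammer a n \<le> (a + real n) ^ n"
  unfolding pochhammer_prod using assms prod_mono[of "{0..<n}" "\<lambda>i. a + real i" "\<lambda>_. a + real n"]
  by simp

lemma power_le_pochhammer:
  fixes a :: real
  assumes "0 \<le> a"
  shows "a ^ n \<le> pochhammer a n"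
  unfolding pochhammer_prod using assms prod_mono[of "{0..<n}" "\<lambda>_. a" "\<lambda>i. a + real i"]
  by simp

text \<open>The discrete power rule: the two products share (a+1)...(a+n), and the leftover factors
  a+n+1 and a differ by n+1.\<close>

lemma pochhammer_increment:
  fixes a :: real
  shows "pochhammer (a + 1) (Suc n) - pochhammer a (Suc n) = real (Suc n) * pochhammer (a + 1) n"
  unfolding pochhammer_Suc[of "a + 1"] pochhammer_rec[of a] by (simp add: algebra_simps)

text \<open>Split p/(p-1) as 1 + 1/(p-1). Bounding each factor of \<open>?P\<close> by k+p controls
  the root of the increment by a multiple of k+p, exactly the factor that completes
  \<open>?P\<close> to the rising factorial in \<open>A (Suc k)\<close>.\<close>

lemma weight_increment_powr_le:
  fixes \<delta> :: real and A :: "nat \<Rightarrow> real"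
  assumes p: "1 < p" and \<delta>: "0 < \<delta>"
    and A: "\<forall>k. A k = (\<delta> / real p) ^ p * pochhammer (real k) p"
  shows "(A (Suc k) - A k) powr (real p / (real p - 1))
    \<le> \<delta> powr (real p / (real p - 1)) * A (Suc k)"
proof -
  define n where "n = p - 1"
  have n: "p = Suc n" "0 < n" "real p - 1 = real n"
    using p by (auto simp: n_def)
  let ?P = "pochhammer (real k + 1) n"
  have P: "0 < ?P"
    by (intro pochhammer_pos) simp
  have incr: "A (Suc k) - A k = (\<delta> / real p) ^ p * real p * ?P"
    using pochhammer_increment[of "real k" n] A
    by (simp add: n(1) add.commute mult.assoc del: power_Suc flip: right_diff_distrib)
  have "(A (Suc k) - A k) powr (1 / real n)
      \<le> ((\<delta> / real p) ^ p * real p * (real k + real p) ^ n) powr (1 / real n)"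
    unfolding incr using pochhammer_le_power[of "real k + 1" n] \<delta> p P
    by (intro powr_mono2 mult_left_mono) (auto simp: n add_ac)
  \<comment> \<open>One factor p cancels, so apart from the power of \<open>\<delta>\<close> this is
    a perfect n-th power.\<close>
  also have "(\<delta> / real p) ^ p * real p * (real k + real p) ^ n
      = \<delta> ^ p * ((real k + real p) / real p) ^ n"
    by (simp add: n power_divide)
  also have "\<dots> powr (1 / real n) = \<delta> powr (real p / real n) * ((real k + real p) / real p)"
  proof -
    have "\<delta> ^ p = \<delta> powr real p"
      "((real k + real p) / real p) ^ n = ((real k + real p) / real p) powr real n"
      using \<delta> p by (simp_all add: powr_realpow)
    then show ?thesis
      using \<delta> p n(2) by (simp add: powr_mult powr_powr)
  qed
  finally have root: "(A (Suc k) - A k) powr (1 / real n)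
      \<le> \<delta> powr (real p / real n) * ((real k + real p) / real p)" .
  have pos: "0 < A (Suc k) - A k"
    unfolding incr using P \<delta> p by simp
  have "real p / real n = 1 + 1 / real n"
    using n by (simp add: field_simps)
  then have "(A (Suc k) - A k) powr (real p / real n)
      = (A (Suc k) - A k) * (A (Suc k) - A k) powr (1 / real n)"
    using pos by (simp add: powr_add)
  also have "\<dots> \<le> (A (Suc k) - A k) * (\<delta> powr (real p / real n) * ((real k + real p) / real p))"
    using root pos by (intro mult_left_mono) auto
  also have "\<dots> = \<delta> powr (real p / real n) * A (Suc k)"
  proof -
    have "A (Suc k) = (\<delta> / real p) ^ p * (?P * (real k + real p))"
      using A by (simp add: n pochhammer_Suc add_ac)
    then show ?thesis
      unfolding incr using p by simp
  qed
  finally show ?thesis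
    by (simp add: n)
qed

text \<open>The updates enter only through their consequences: the coupling cleared of denominators,
  the optimality condition of the mirror step, and the descent inequality.\<close>

lemma accelerated_rescaled_gradient_gap:
  fixes B :: "'a::euclidean_space \<Rightarrow> 'a"
    and f h :: "'a \<Rightarrow> real"
    and A :: "nat \<Rightarrow> real"
    and x y z :: "nat \<Rightarrow> 'a"
  assumes B: "pos_def_selfadjoint B"
    and p: "1 < p"
    and f_convex: "convex_on UNIV f"
    and f_diff: "\<forall>u. f differentiable at u"
    and h_convex: "\<forall>u v. bregman h u v \<ge> 1 / real p * norm_on B (u - v) ^ p"
    and \<delta>: "0 < \<delta>"
    and A: "\<forall>k. A k = (\<delta> / real p) ^ p * pochhammer (real k) p"
    and x: "\<forall>k. A (Suc k) *\<^sub>R x k = (A (Suc k) - A k) *\<^sub>R z k + A k *\<^sub>R y k"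
    and z: "\<forall>k. gradient h (z (Suc k)) - gradient h (z k)
          = - ((A (Suc k) - A k) *\<^sub>R gradient f (x k))"
    and descent: "\<forall>k. f (y (Suc k)) \<le> f (x k)
          - (\<delta> * dual_norm_on B (gradient f (x k))) powr (real p / (real p - 1))"
  shows "A k * (f (y k) - f u) + bregman h u (z k) \<le> bregman h u (z 0)"
proof (induction k)
  \<comment> \<open>The rising factorial of 0 contains the factor 0, so the unspecified
    \<open>y 0\<close> drops out.\<close>
  case 0
  then show ?case
    using A p by (simp add: pochhammer_0_left)
next
  case (Suc k)
  let ?g = "gradient f (x k)"
  let ?G = "dual_norm_on B ?g"
  let ?q = "real p / (real p - 1)"
  define a where "a = A (Suc k) - A k"
  have G: "0 \<le> ?G"
    by (rule dual_norm_on_nonneg[OF B])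
  have A_nonneg: "0 \<le> A i" for i
    using A \<delta> by (simp add: pochhammer_prod prod_nonneg)
  have a: "0 \<le> a"
  proof -
    have "pochhammer (real k) p \<le> pochhammer (real (Suc k)) p"
      unfolding pochhammer_prod by (intro prod_mono) auto
    then show ?thesis
      using A \<delta> by (simp add: a_def mult_left_mono)
  qed
  have "bregman h u (z (Suc k)) = bregman h u (z k) - bregman h (z (Suc k)) (z k)
      + a * (?g \<bullet> (u - z (Suc k)))"
    using bregman_three_point[of h u "z (Suc k)" "z k"] z by (simp add: a_def)
  \<comment> \<open>Splitting at \<open>z k\<close> separates a part for convexity of
    \<open>f\<close> from a part that the divergence of the mirror step controls by
    Fenchel-Young.\<close>
  also have "\<dots> = bregman h u (z k) + a * (?g \<bullet> (u - z k))
      + ((a *\<^sub>R ?g) \<bullet> (z k - z (Suc k)) - bregman h (z (Suc k)) (z k))"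
    by (simp add: algebra_simps)
  also have "\<dots> \<le> bregman h u (z k) + a * (?g \<bullet> (u - z k))
      + (real p - 1) / real p * (a * ?G) powr ?q"
  proof -
    have "norm_on B (z k - z (Suc k)) = norm_on B (z (Suc k) - z k)"
      using norm_on_minus[OF B, of "z k - z (Suc k)"] by simp
    moreover have "dual_norm_on B (a *\<^sub>R ?g) = a * ?G"
      using a by (simp add: dual_norm_on_scaleR[OF B])
    ultimately show ?thesis
      using fenchel_young[OF B p, of "a *\<^sub>R ?g" "z k - z (Suc k)"]
        h_convex[rule_format, of "z (Suc k)" "z k"]
      by simp
  qed
  \<comment> \<open>The coupling says that a (z - x) = A (x - y) at index k, which trades
    \<open>z k\<close> for \<open>x k\<close> and \<open>y k\<close>.\<close>
  also have "a * (?g \<bullet> (u - z k)) = a * (?g \<bullet> (u - x k)) + A k * (?g \<bullet> (y k - x k))"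
  proof -
    have "a *\<^sub>R (u - z k) = a *\<^sub>R (u - x k) + A k *\<^sub>R (y k - x k)"
      using x[rule_format, of k] by (simp add: a_def algebra_simps)
    then show ?thesis
      by (metis inner_add_right inner_scaleR_right)
  qed
  also have "\<dots> \<le> a * (f u - f (x k)) + A k * (f (y k) - f (x k))"
    using convex_above_gradient[OF f_convex, of "x k"] f_diff a A_nonneg
    by (intro add_mono mult_left_mono) (simp_all add: le_diff_eq add.commute)
  \<comment> \<open>The factor (p-1)/p is at most 1 and is discarded.\<close>
  also have "(real p - 1) / real p * (a * ?G) powr ?q \<le> A (Suc k) * (\<delta> * ?G) powr ?q"
  proof -
    have "(a * ?G) powr ?q = a powr ?q * ?G powr ?q"
      using a G by (simp add: powr_mult)
    also have "\<dots> \<le> \<delta> powr ?q * A (Suc k) * ?G powr ?q"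
      using weight_increment_powr_le[OF p \<delta> A, of k] by (intro mult_right_mono) (auto simp: a_def)
    also have "\<dots> = A (Suc k) * (\<delta> * ?G) powr ?q"
      using \<delta> G by (simp add: powr_mult)
    finally show ?thesis
      using p mult_left_le_one_le[of "(a * ?G) powr ?q" "(real p - 1) / real p"] by simp
  qed
  also have "A (Suc k) * (\<delta> * ?G) powr ?q \<le> A (Suc k) * (f (x k) - f (y (Suc k)))"
    using descent[rule_format, of k] A_nonneg[of "Suc k"] by (intro mult_left_mono) auto
  \<comment> \<open>The values \<open>f (x k)\<close> cancel because
    \<open>a + A k = A (Suc k)\<close>.\<close>
  finally have "A (Suc k) * (f (y (Suc k)) - f u) + bregman h u (z (Suc k))
      \<le> A k * (f (y k) - f u) + bregman h u (z k)"
    by (simp add: a_def algebra_simps)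
  with Suc show ?case
    by linarith
qed

section \<open>Convergence rate of the accelerated method\<close>

theorem theorem8:
  fixes B :: "'a::euclidean_space \<Rightarrow> 'a"
    and f h :: "'a \<Rightarrow> real"
    and xstar :: 'a
    and p :: nat
    and L :: "nat \<Rightarrow> real"
    and \<eta> \<delta> :: real
    and A \<alpha> \<tau> :: "nat \<Rightarrow> real"
    and x y z :: "nat \<Rightarrow> 'a"
  assumes B: "pos_def_selfadjoint B"
    and p: "1 < p"
    and f_convex: "convex_on UNIV f"
    and f_min: "is_arg_min f (\<lambda>_. True) xstar"
    and f_smooth: "strongly_smooth B p L f"
    and eta_pos: "0 < \<eta>"
    and eta_le: "\<eta> powr (1 / (real p - 1)) \<le> min 1 (1 / (2 * (\<Sum>m=2..p. L m / fact m)))"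
    and h_diff: "\<forall>u. h differentiable at u"
    and h_convex: "\<forall>u v. bregman h u v \<ge> 1 / real p * norm_on B (u - v) ^ p"
    and delta_pos: "0 < \<delta>"
    and delta_eq: "\<delta> powr (real p / (real p - 1)) = \<eta> powr (1 / (real p - 1)) / 2"
    and A_def: "\<forall>k. A k = (\<delta> / real p) ^ p * pochhammer (real k) p"
    and alpha_def: "\<forall>k. \<alpha> k = (A (Suc k) - A k) / \<delta>"
    and tau_def: "\<forall>k. \<tau> k = \<alpha> k / A (Suc k)"
    and init: "x 0 = z 0"
    and x_update: "\<forall>k. x k = (\<delta> * \<tau> k) *\<^sub>R z k + (1 - \<delta> * \<tau> k) *\<^sub>R y k"
    and z_update: "\<forall>k. is_arg_min
          (\<lambda>u. \<alpha> k * (gradient f (x k) \<bullet> u) + 1 / \<delta> * bregman h u (z k)) (\<lambda>_. True) (z (Suc k))"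
    and y_update: "\<forall>k. y (Suc k) =
          (if gradient f (x k) = 0 then x k
           else x k - (\<eta> powr (1 / (real p - 1))
                        / dual_norm_on B (gradient f (x k)) powr ((real p - 2) / (real p - 1)))
                      *\<^sub>R inv B (gradient f (x k)))"
  shows "(\<forall>k\<ge>1. f (y k) - f xstar \<le> real p ^ p * bregman h xstar (z 0) / (\<delta> * real k) ^ p)
       \<and> (\<lambda>k. real p ^ p * bregman h xstar (z 0) / (\<delta> * real k) ^ p) \<in> O(\<lambda>k. 1 / (\<delta> * real k) ^ p)
       \<and> (\<lambda>k. f (y k) - f xstar) \<in> O(\<lambda>k. 1 / (\<delta> * real k) ^ p)"
proof -
  define c where "c = \<eta> powr (1 / (real p - 1))"
  let ?q = "real p / (real p - 1)"
  let ?bound = "\<lambda>k. real p ^ p * bregman h xstar (z 0) / (\<delta> * real k) ^ p"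
  have f_diff: "\<forall>u. f differentiable at u"
    using f_smooth p by (cases p) (auto simp: strongly_smooth_def)
  have gap_nonneg: "0 \<le> f u - f xstar" for u
    using f_min by (simp add: is_arg_min_linorder)
  have h_nonneg: "0 \<le> bregman h u v" for u v
  proof -
    have "0 \<le> 1 / real p * norm_on B (u - v) ^ p"
      using norm_on_nonneg[OF B] by simp
    then show ?thesis
      using h_convex order_trans by blast
  qed
  have delta_alpha: "\<delta> * \<alpha> k = A (Suc k) - A k" for k
    using alpha_def delta_pos by simp
  have A_pos: "0 < A (Suc k)" for k
    using A_def delta_pos p pochhammer_pos[of "real (Suc k)" p] by simp
  have "A (Suc k) *\<^sub>R x k = (A (Suc k) - A k) *\<^sub>R z k + A k *\<^sub>R y k" for k
  proof -
    have "A (Suc k) * (\<delta> * \<tau> k) = A (Suc k) - A k"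
      using tau_def delta_alpha[of k] A_pos[of k] by simp
    moreover from this have "A (Suc k) * (1 - \<delta> * \<tau> k) = A k"
      by (simp add: right_diff_distrib)
    ultimately show ?thesis
      using x_update by (metis scaleR_add_right scaleR_scaleR)
  qed
  moreover have "gradient h (z (Suc k)) - gradient h (z k)
      = - ((A (Suc k) - A k) *\<^sub>R gradient f (x k))" for k
  proof -
    have "\<delta> *\<^sub>R (1 / \<delta>) *\<^sub>R (gradient h (z (Suc k)) - gradient h (z k))
        = \<delta> *\<^sub>R (- (\<alpha> k *\<^sub>R gradient f (x k)))"
      using gradient_bregman_minimizer[OF h_diff z_update[rule_format]] by simp
    then show ?thesis
      using delta_pos delta_alpha[of k] by simp
  qed
  moreover have "f (y (Suc k)) \<le> f (x k) - (\<delta> * dual_norm_on B (gradient f (x k))) powr ?q" for k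
  proof (cases "gradient f (x k) = 0")
    case True
    then show ?thesis
      using y_update by (simp add: dual_norm_on_def)
  next
    case False
    \<comment> \<open>The choice of \<open>\<delta>\<close> makes its power equal to
      \<open>c / 2\<close>, the coefficient of the guaranteed descent.\<close>
    have "(\<delta> * dual_norm_on B (gradient f (x k))) powr ?q
        = c / 2 * dual_norm_on B (gradient f (x k)) powr ?q"
      using delta_pos dual_norm_on_nonneg[OF B] delta_eq by (simp add: powr_mult c_def)
    then show ?thesis
      using rescaled_gradient_descent[OF B f_smooth _ _ _ False, of c] y_update False eta_pos eta_le
      by (simp flip: c_def) (simp add: c_def)
  qed
  ultimately have lyapunov:
    "A k * (f (y k) - f xstar) + bregman h xstar (z k) \<le> bregman h xstar (z 0)" for k
    using accelerated_rescaled_gradient_gap[OF B p f_convex f_diff h_convex delta_pos A_def] by blast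
  have bound: "f (y k) - f xstar \<le> ?bound k" if "1 \<le> k" for k
  proof -
    \<comment> \<open>The rising factorial dominates the plain power; the gap is nonnegative, so the
      smaller weight may replace \<open>A k\<close>.\<close>
    have "(\<delta> * real k) ^ p / real p ^ p \<le> A k"
      using A_def power_le_pochhammer[of "real k" p] delta_pos
      by (simp add: power_divide power_mult_distrib divide_right_mono)
    then have "(\<delta> * real k) ^ p / real p ^ p * (f (y k) - f xstar) \<le> A k * (f (y k) - f xstar)"
      by (intro mult_right_mono gap_nonneg)
    also have "\<dots> \<le> bregman h xstar (z 0)"
      using lyapunov[of k] h_nonneg[of xstar "z k"] by linarith
    finally show ?thesis
      using that delta_pos p by (simp add: field_simps)
  qed
  have bound_bigo: "?bound \<in> O(\<lambda>k. 1 / (\<delta> * real k) ^ p)"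
    by (rule bigoI[where c = "real p ^ p * bregman h xstar (z 0)"])
      (use h_nonneg delta_pos in \<open>simp add: abs_mult\<close>)
  \<comment> \<open>Big-O concerns absolute values, so minimality of \<open>xstar\<close> is used
    too. The comparison starts at k = 1: at k = 0 division by zero makes the bound 0.\<close>
  moreover have "(\<lambda>k. f (y k) - f xstar) \<in> O(?bound)"
  proof (rule bigoI[where c = 1])
    have "norm (f (y k) - f xstar) \<le> 1 * norm (?bound k)" if "1 \<le> k" for k
      unfolding real_norm_def
      using bound[OF that] gap_nonneg[of "y k"] abs_ge_self[of "?bound k"] by linarith
    then show "\<forall>\<^sub>F k in sequentially. norm (f (y k) - f xstar) \<le> 1 * norm (?bound k)"
      by (meson eventually_sequentiallyI)
  qed
  ultimately show ?thesis
    using bound landau_o.big_trans by blast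
qed

end
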